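(* Let $\gamma\in[0,1)$ and let $Q,P\in\mathbb{R}^{(m+vn_u)\times(m+vn_u)}$ be symmetric positive definite. Let $\mathbb{S}$, $\mathrm{V}$, $\mathrm{M}$, $\mathbb{T}$ be as defined in the context. Suppose there exists a pair $(y,u)\in\mathbb{R}^m\times\mathbb{R}^{vn_u}$ with $(y,u,y)\in\mathbb{S}$. Then for any $(y_{\mathrm{s}},u_{\mathrm{s}})\in\mathbb{R}^m\times\mathbb{R}^{vn_u}$ satisfying $(y_{\mathrm{s}},u_{\mathrm{s}},y_{\mathrm{s}})\in\mathbb{S}$, the function $y\mapsto \mathrm{M}(y,y_{\mathrm{s}},u_{\mathrm{s}})$ is positive definite at $y=y_{\mathrm{s}}$, that is, $\mathrm{M}(y_{\mathrm{s}},y_{\mathrm{s}},u_{\mathrm{s}})=0$ and $\mathrm{M}(y,y_{\mathrm{s}},u_{\mathrm{s}})>0$ (possibly $+\infty$) for all $y\neq y_{\mathrm{s}}$. Moreover, if the matrix inequality $Q+\gamma^2P\preceq P$ holds, then for any such $(y_{\mathrm{s}},u_{\mathrm{s}})$ and any $\bar y\in\mathbb{T}(y_{\mathrm{s}},u_{\mathrm{s}})$, $$\min_{y^+\in\mathbb{R}^m}\left\{\mathrm{M}(y^+,y_{\mathrm{s}},u_{\mathrm{s}})+\mathrm{V}(\bar y,y^+,y_{\mathrm{s}},u_{\mathrm{s}})\right\}\le \mathrm{M}(\bar y,y_{\mathrm{s}},u_{\mathrm{s}}).$$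
   Context: Setting. $\mathcal{X}\subseteq\mathbb{R}^{n_x}$ and $\mathcal{U}\subseteq\mathbb{R}^{n_u}$ are closed convex sets (state and input constraints), $\mathcal{W}\subset\mathbb{R}^{n_x}$ is a compact convex set (disturbances), and $(A_1,B_1),\dots,(A_p,B_p)$ are given matrix pairs with $A_i\in\mathbb{R}^{n_x\times n_x}$, $B_i\in\mathbb{R}^{n_x\times n_u}$; the uncertain system is $x^+=Ax+Bu+w$ with $w\in\mathcal{W}$ and $(A,B)$ in the convex hull of these pairs. A matrix $F\in\mathbb{R}^{m\times n_x}$ is given, and for $y\in\mathbb{R}^m$ one sets $X(y)=\{x\in\mathbb{R}^{n_x}: Fx\le y\}$. A matrix $E$ with $m$ columns and matrices $V_1,\dots,V_v\in\mathbb{R}^{n_x\times m}$ are given such that $X(y)$ is the convex hull of $\{V_1y,\dots,V_vy\}$ whenever $Ey\le 0$. Vectors $u\in\mathbb{R}^{vn_u}$ are stacked as $u=(u_1,\dots,u_v)$ with $u_j\in\mathbb{R}^{n_u}$, and $U_j\in\mathbb{R}^{n_u\times vn_u}$ is the matrix with $U_ju=u_j$. The vector $d\in\mathbb{R}^m$ has components $d_i=\max\{F_iw: w\in\mathcal{W}\}$, where $F_i$ is the $i$-th row of $F$. All vector inequalities are componentwise. The set $\mathbb{S}\subseteq\mathbb{R}^m\times\mathbb{R}^{vn_u}\times\mathbb{R}^m$ consists of all $(y,u,y^+)$ such that for all $i\in\{1,\dots,p\}$ and $j\in\{1,\dots,v\}$: $$F(A_iV_jy+B_iU_ju)+d\le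 y^+,\qquad Ey\le 0,\qquad V_jy\in\mathcal{X},\qquad U_ju\in\mathcal{U}.$$ For a symmetric matrix $R$, $\|z\|_R^2:=z^\top Rz$; $(a,b)$ denotes the stacked column vector. Define $$\mathrm{V}(y,y^+,y_{\mathrm{s}},u_{\mathrm{s}}):=\min_{u}\ \|(y-y_{\mathrm{s}},\,u-u_{\mathrm{s}})\|_Q^2\quad\text{s.t. }(y,u,y^+)\in\mathbb{S},$$ $$\mathrm{M}(y,y_{\mathrm{s}},u_{\mathrm{s}}):=\min_{u}\ \|(y-y_{\mathrm{s}},\,u-u_{\mathrm{s}})\|_P^2\quad\text{s.t. }(y,u,\gamma y+(1-\gamma)y_{\mathrm{s}})\in\mathbb{S},$$ each with value $+\infty$ if the minimization problem is infeasible, and $\mathbb{T}(y_{\mathrm{s}},u_{\mathrm{s}}):=\{y\in\mathbb{R}^m:\mathrm{M}(y,y_{\mathrm{s}},u_{\mathrm{s}})<\infty\}$. *)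

theory Defs
  imports "HOL-Analysis.Analysis"
begin

section \<open>Stacked vectors and quadratic forms\<close>

text \<open>The stacked vector \<open>(a, b)\<close>; the index set of the result is the disjoint sum of the
  two index sets.\<close>

definition stack :: "real^'a \<Rightarrow> real^'b \<Rightarrow> real^('a + 'b)" where
  "stack a b = (\<chi> i. case i of Inl k \<Rightarrow> a $ k | Inr k \<Rightarrow> b $ k)"

text \<open>A vector \<open>u = (u\<^sub>1, \<dots>, u\<^sub>v)\<close> made of blocks \<open>u\<^sub>j \<in> \<real>\<^sup>n\<close> is indexed by pairs: component
  \<open>(j, k)\<close> of \<open>u\<close> is component \<open>k\<close> of the block \<open>u\<^sub>j\<close>. The matrix below extracts \<open>u\<^sub>j\<close>.\<close>

definition block_mat :: "'v::finite \<Rightarrow> real^('v \<times> 'n)^'n" where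
  "block_mat j = (\<chi> k l. if l = (j, k) then 1 else 0)"

lemma block_mat_mult: "block_mat j *v u = (\<chi> k. u $ (j, k))"
  by (simp add: block_mat_def matrix_vector_mult_def vec_eq_iff if_distrib if_distribR
      cong: if_cong)

definition quad_form :: "real^'a^'a \<Rightarrow> real^'a \<Rightarrow> real" where
  "quad_form R z = z \<bullet> (R *v z)"

definition sym_pos_def :: "real^'a^'a \<Rightarrow> bool" where
  "sym_pos_def R \<longleftrightarrow> transpose R = R \<and> (\<forall>z. z \<noteq> 0 \<longrightarrow> quad_form R z > 0)"

definition sym_pos_semidef :: "real^'a^'a \<Rightarrow> bool" where
  "sym_pos_semidef R \<longleftrightarrow> transpose R = R \<and> (\<forall>z. quad_form R z \<ge> 0)"

definition loewner_le :: "real^'a^'a \<Rightarrow> real^'a^'a \<Rightarrow> bool" (infix "\<preceq>\<^sub>L" 50) where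
  "R \<preceq>\<^sub>L R' \<longleftrightarrow> sym_pos_semidef (R' - R)"

section \<open>Minimum values\<close>

text \<open>This is a minimum, not an infimum: if \<open>C\<close> is nonempty and \<open>f\<close> has no minimizer on \<open>C\<close>,
  the value is unspecified. Statements about it therefore involve attainment.\<close>

definition min_over :: "'a set \<Rightarrow> ('a \<Rightarrow> ereal) \<Rightarrow> ereal" where
  "min_over C f = (if C = {} then \<infinity> else (LEAST r. r \<in> f ` C))"

lemma min_over_eqI:
  assumes "x \<in> C" "\<And>z. z \<in> C \<Longrightarrow> f x \<le> f z"
  shows "min_over C f = f x"
proof -
  have "(LEAST r. r \<in> f ` C) = f x"
    by (rule Least_equality) (use assms in auto)
  then show ?thesis
    using assms(1) by (auto simp: min_over_def)
qed

section \<open>Configuration-constrained tubes\<close>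

definition polytope_of :: "real^'nx^'m \<Rightarrow> real^'m \<Rightarrow> (real^'nx) set" where
  "polytope_of F y = {x. F *v x \<le> y}"

definition disturbance_bound :: "real^'nx^'m \<Rightarrow> (real^'nx) set \<Rightarrow> real^'m" where
  "disturbance_bound F W = (\<chi> i. GREATEST r. r \<in> (\<lambda>w. row i F \<bullet> w) ` W)"

definition tube_set ::
  "(real^'nx) set \<Rightarrow> (real^'nu) set \<Rightarrow> (real^'nx) set \<Rightarrow>
   ('p \<Rightarrow> real^'nx^'nx) \<Rightarrow> ('p \<Rightarrow> real^'nu^'nx) \<Rightarrow>
   real^'nx^'m \<Rightarrow> real^'m^'e \<Rightarrow> ('v::finite \<Rightarrow> real^'m^'nx) \<Rightarrow>
   ((real^'m) \<times> (real^('v \<times> 'nu)) \<times> (real^'m)) set" where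
  "tube_set X U W A B F E V = {(y, u, y'). \<forall>i j.
      F *v (A i *v (V j *v y) + B i *v (block_mat j *v u)) + disturbance_bound F W \<le> y' \<and>
      E *v y \<le> 0 \<and> V j *v y \<in> X \<and> block_mat j *v u \<in> U}"

text \<open>The functions \<open>V\<close> and \<open>M\<close> and the domain \<open>T\<close> of \<open>M\<close>, for a given set \<open>S\<close>
  of admissible triples.\<close>

definition stage_cost ::
  "((real^'m) \<times> (real^'k) \<times> (real^'m)) set \<Rightarrow> real^('m + 'k)^('m + 'k) \<Rightarrow>
   real^'m \<Rightarrow> real^'m \<Rightarrow> real^'m \<Rightarrow> real^'k \<Rightarrow> ereal" where
  "stage_cost S Q y y' ys us =
     min_over {u. (y, u, y') \<in> S} (\<lambda>u. ereal (quad_form Q (stack (y - ys) (u - us))))"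

definition terminal_cost ::
  "((real^'m) \<times> (real^'k) \<times> (real^'m)) set \<Rightarrow> real \<Rightarrow> real^('m + 'k)^('m + 'k) \<Rightarrow>
   real^'m \<Rightarrow> real^'m \<Rightarrow> real^'k \<Rightarrow> ereal" where
  "terminal_cost S \<gamma> P y ys us =
     min_over {u. (y, u, \<gamma> *\<^sub>R y + (1 - \<gamma>) *\<^sub>R ys) \<in> S}
       (\<lambda>u. ereal (quad_form P (stack (y - ys) (u - us))))"

definition terminal_set ::
  "((real^'m) \<times> (real^'k) \<times> (real^'m)) set \<Rightarrow> real \<Rightarrow> real^('m + 'k)^('m + 'k) \<Rightarrow>
   real^'m \<Rightarrow> real^'k \<Rightarrow> (real^'m) set" where
  "terminal_set S \<gamma> P ys us = {y. terminal_cost S \<gamma> P y ys us < \<infinity>}"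

end

theory Submission
  imports Defs
begin

text \<open>The tube set is an intersection of preimages of closed convex sets under linear maps, hence
  closed and convex. Positive definite quadratic forms grow quadratically, so all the minima,
  including the one over the successor parameter, are attained. For the descent inequality, let \<open>u\<close>
  be optimal for \<open>M(y, y\<^sub>s, u\<^sub>s)\<close>. The contracted pair \<open>\<gamma>(y, u) + (1 - \<gamma>)(y\<^sub>s, u\<^sub>s)\<close> is
  admissible for the terminal cost at \<open>\<gamma>y + (1 - \<gamma>)y\<^sub>s\<close> by convexity, and its deviation from the
  equilibrium is scaled by \<open>\<gamma>\<close>, so its cost is scaled by \<open>\<gamma>\<^sup>2\<close>.\<close>

section \<open>Stacked vectors and quadratic forms\<close>

lemma stack_scaleR: "stack (c *\<^sub>R a) (c *\<^sub>R b) = c *\<^sub>R stack a b"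
  by (auto simp: stack_def vec_eq_iff split: sum.split)

lemma stack_zero [simp]: "stack 0 0 = 0"
  by (auto simp: stack_def vec_eq_iff split: sum.split)

lemma stack_eq_zero_iff: "stack a b = 0 \<longleftrightarrow> a = 0 \<and> b = 0"
  by (auto simp: stack_def vec_eq_iff split: sum.splits)

text \<open>This lets a lower bound on a form of a stacked vector be read as a lower bound in each
  block separately, which is how coercivity in the individual variables is obtained below.\<close>

lemma norm_stack: "(norm (stack a b))\<^sup>2 = (norm a)\<^sup>2 + (norm b)\<^sup>2"
proof -
  have "stack a b \<bullet> stack a b = a \<bullet> a + b \<bullet> b"
    by (simp add: inner_vec_def stack_def UNIV_Plus_UNIV [symmetric] sum.Plus
        del: UNIV_Plus_UNIV)
  then show ?thesis
    by (simp add: power2_norm_eq_inner)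
qed

lemma continuous_on_stack [continuous_intros]:
  assumes "continuous_on D f" "continuous_on D g"
  shows "continuous_on D (\<lambda>x. stack (f x) (g x))"
  unfolding stack_def
proof (intro continuous_on_vec_lambda)
  fix i :: "'b + 'c"
  show "continuous_on D (\<lambda>x. case i of Inl k \<Rightarrow> f x $ k | Inr k \<Rightarrow> g x $ k)"
    by (cases i) (auto intro!: continuous_intros assms)
qed

lemma continuous_on_quad_form [continuous_intros]:
  assumes "continuous_on D f"
  shows "continuous_on D (\<lambda>x. quad_form R (f x))"
  unfolding quad_form_def
  by (intro continuous_intros assms
        bounded_linear.continuous_on [OF matrix_vector_mul_bounded_linear])

lemma quad_form_scaleR: "quad_form R (c *\<^sub>R z) = c\<^sup>2 * quad_form R z"
  by (simp add: quad_form_def matrix_vector_mult_scaleR power2_eq_square)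

lemma quad_form_zero [simp]: "quad_form R 0 = 0"
  by (simp add: quad_form_def)

lemma quad_form_nonneg: "sym_pos_def R \<Longrightarrow> 0 \<le> quad_form R z"
  by (cases "z = 0") (auto simp: sym_pos_def_def less_imp_le)

text \<open>The constant is the minimum of the form on the unit sphere: it is attained by
  compactness and positive by definiteness. Homogeneity of degree two carries the bound from the
  sphere to every vector.\<close>

lemma quad_form_coercive:
  assumes "sym_pos_def R"
  obtains c where "c > 0" "\<And>z. c * (norm z)\<^sup>2 \<le> quad_form R z"
proof -
  have "sphere (0 :: real^'a) 1 \<noteq> {}"
    by simp
  moreover have "continuous_on (sphere 0 1) (quad_form R)"
    using continuous_on_quad_form [OF continuous_on_id] by simp
  ultimately obtain x where x: "x \<in> sphere 0 1"
    "\<And>z. z \<in> sphere 0 1 \<Longrightarrow> quad_form R x \<le> quad_form R z"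
    using continuous_attains_inf [OF compact_sphere] by blast
  show thesis
  proof
    show "quad_form R x > 0"
      using assms x(1) by (cases "x = 0") (auto simp: sym_pos_def_def)
    fix z :: "real^'a"
    show "quad_form R x * (norm z)\<^sup>2 \<le> quad_form R z"
    proof (cases "z = 0")
      case False
      then have "quad_form R x \<le> quad_form R ((1 / norm z) *\<^sub>R z)"
        by (intro x(2)) simp
      with False show ?thesis
        by (simp add: quad_form_scaleR power_divide field_simps)
    qed simp
  qed
qed

lemma quad_form_loewner_le:
  assumes "R \<preceq>\<^sub>L R'"
  shows "quad_form R z \<le> quad_form R' z"
  using assms unfolding loewner_le_def sym_pos_semidef_def quad_form_def
  by (auto simp: matrix_vector_mult_diff_rdistrib inner_diff_right)

lemma quad_form_add: "quad_form (R + R') z = quad_form R z + quad_form R' z"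
  by (simp add: quad_form_def matrix_vector_mult_add_rdistrib inner_add_right)

lemma quad_form_scaleR_matrix: "quad_form (c *\<^sub>R R) z = c * quad_form R z"
  by (simp add: quad_form_def scaleR_matrix_vector_assoc [symmetric])

section \<open>Attainment of minima by coercivity\<close>

lemma coercive_attains_inf:
  fixes f :: "'a::heine_borel \<Rightarrow> real"
  assumes "closed C" "C \<noteq> {}" "continuous_on C f" "c > 0"
    and coercive: "\<And>z. z \<in> C \<Longrightarrow> c * (dist z z0)\<^sup>2 \<le> f z"
  obtains x where "x \<in> C" "\<And>z. z \<in> C \<Longrightarrow> f x \<le> f z"
proof -
  obtain a where a: "a \<in> C"
    using \<open>C \<noteq> {}\<close> by blast
  \<comment> \<open>The sublevel set through an arbitrary feasible point \<open>a\<close>: it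
    contains \<open>a\<close>, and coercivity confines it to a ball, so it is compact.\<close>
  define D where "D = C \<inter> f -` {..f a}"
  have "closed D"
    unfolding D_def using assms by (intro continuous_closed_preimage) auto
  moreover have "D \<subseteq> cball z0 (sqrt (f a / c))"
  proof
    fix z assume "z \<in> D"
    with coercive [of z] have "c * (dist z z0)\<^sup>2 \<le> f a"
      by (auto simp: D_def)
    then have "(dist z z0)\<^sup>2 \<le> f a / c"
      using \<open>c > 0\<close> by (simp add: field_simps)
    then show "z \<in> cball z0 (sqrt (f a / c))"
      by (simp add: dist_commute real_le_rsqrt)
  qed
  ultimately have "compact D"
    using bounded_cball bounded_subset compact_eq_bounded_closed by blast
  moreover have "a \<in> D" "continuous_on D f"
    using a assms by (auto simp: D_def intro: continuous_on_subset)
  ultimately obtain x where x: "x \<in> D" "\<And>z. z \<in> D \<Longrightarrow> f x \<le> f z"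
    using continuous_attains_inf by (metis empty_iff)
  \<comment> \<open>Points of \<open>C\<close> outside \<open>D\<close> have values above
    \<open>f a\<close>, hence above \<open>f x\<close>.\<close>
  have "f x \<le> f z" if "z \<in> C" for z
    using x(2) [of z] x(2) [OF \<open>a \<in> D\<close>] that by (cases "f z \<le> f a") (auto simp: D_def)
  with x(1) show thesis
    using that by (auto simp: D_def)
qed

text \<open>With the first block \<open>a\<close> fixed, the squared norm of the stacked vector is
  at least the squared distance from \<open>u\<close> to \<open>us\<close>, so the cost is coercive
  in \<open>u\<close> around \<open>us\<close>.\<close>

lemma quad_form_stack_attains_min:
  fixes C :: "(real^'k::finite) set" and R :: "real^('m::finite + 'k::finite)^('m + 'k)"
  assumes R: "sym_pos_def R" and "closed C" "C \<noteq> {}"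
  obtains u where "u \<in> C"
    "\<And>w. w \<in> C \<Longrightarrow> quad_form R (stack a (u - us)) \<le> quad_form R (stack a (w - us))"
proof -
  obtain c where c: "c > 0" "\<And>z. c * (norm z)\<^sup>2 \<le> quad_form R z"
    using quad_form_coercive [OF R] by blast
  have bound: "c * (dist u us)\<^sup>2 \<le> quad_form R (stack a (u - us))" for u
  proof -
    have "c * (dist u us)\<^sup>2 \<le> c * (norm (stack a (u - us)))\<^sup>2"
      using c(1) by (simp add: norm_stack dist_norm)
    with c(2) show ?thesis
      using order_trans by blast
  qed
  have cont: "continuous_on C (\<lambda>u. quad_form R (stack a (u - us)))"
    by (intro continuous_intros)
  show thesis
    by (rule coercive_attains_inf [OF \<open>closed C\<close> \<open>C \<noteq> {}\<close> cont c(1) bound]) (rule that)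
qed

lemma min_over_empty [simp]: "min_over {} f = \<infinity>"
  by (simp add: min_over_def)

text \<open>For closed \<open>C\<close>, attainment excludes the case in which \<open>LEAST\<close>
  in \<open>min_over\<close> is unspecified. Either the value is \<infinity> by convention or there
  is a genuine minimizer; all later reasoning about the costs goes through this dichotomy.\<close>

lemma min_over_quad_form_cases:
  fixes C :: "(real^'k::finite) set" and R :: "real^('m::finite + 'k::finite)^('m + 'k)"
  assumes "sym_pos_def R" "closed C"
  obtains (infeasible) "C = {}" "min_over C (\<lambda>u. ereal (quad_form R (stack a (u - us)))) = \<infinity>"
  | (attained) u where "u \<in> C"
      "min_over C (\<lambda>u. ereal (quad_form R (stack a (u - us)))) = ereal (quad_form R (stack a (u - us)))"
      "\<And>w. w \<in> C \<Longrightarrow> quad_form R (stack a (u - us)) \<le> quad_form R (stack a (w - us))"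
proof (cases "C = {}")
  case False
  obtain u where u: "u \<in> C"
    "\<And>w. w \<in> C \<Longrightarrow> quad_form R (stack a (u - us)) \<le> quad_form R (stack a (w - us))"
    using quad_form_stack_attains_min [OF assms False] by blast
  moreover have "min_over C (\<lambda>u. ereal (quad_form R (stack a (u - us)))) =
      ereal (quad_form R (stack a (u - us)))"
    by (rule min_over_eqI) (use u in auto)
  ultimately show thesis
    using attained by blast
qed (use infeasible in simp)

section \<open>Terminal and stage costs over a closed set of triples\<close>

locale closed_triples =
  fixes S :: "((real^'m::finite) \<times> (real^'k::finite) \<times> (real^'m)) set"
    and \<gamma> :: real and Q P :: "real^('m::finite + 'k::finite)^('m + 'k)"
  assumes closed_S: "closed S" and Q: "sym_pos_def Q" and P: "sym_pos_def P"
begin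

lemma closed_stage: "closed {u. (y, u, y') \<in> S}"
proof -
  have "closed ((\<lambda>u. (y, u, y')) -` S)"
    by (intro closed_vimage closed_S continuous_intros)
  then show ?thesis
    by (simp add: vimage_def)
qed

lemma terminal_cost_cases:
  obtains (infeasible) "{u. (y, u, \<gamma> *\<^sub>R y + (1 - \<gamma>) *\<^sub>R ys) \<in> S} = {}"
      "terminal_cost S \<gamma> P y ys us = \<infinity>"
  | (attained) u where "(y, u, \<gamma> *\<^sub>R y + (1 - \<gamma>) *\<^sub>R ys) \<in> S"
      "terminal_cost S \<gamma> P y ys us = ereal (quad_form P (stack (y - ys) (u - us)))"
      "\<And>w. (y, w, \<gamma> *\<^sub>R y + (1 - \<gamma>) *\<^sub>R ys) \<in> S \<Longrightarrow>
        quad_form P (stack (y - ys) (u - us)) \<le> quad_form P (stack (y - ys) (w - us))"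
proof (cases rule: min_over_quad_form_cases [OF P closed_stage,
      of y "\<gamma> *\<^sub>R y + (1 - \<gamma>) *\<^sub>R ys" "y - ys" us,
      case_names infeasible attained])
  case infeasible
  then show thesis
    by (intro that(1)) (auto simp: terminal_cost_def)
next
  case (attained u)
  then show thesis
    by (intro that(2) [of u]) (auto simp: terminal_cost_def)
qed

lemma stage_cost_cases:
  obtains (infeasible) "{u. (y, u, y') \<in> S} = {}" "stage_cost S Q y y' ys us = \<infinity>"
  | (attained) u where "(y, u, y') \<in> S"
      "stage_cost S Q y y' ys us = ereal (quad_form Q (stack (y - ys) (u - us)))"
      "\<And>w. (y, w, y') \<in> S \<Longrightarrow>
        quad_form Q (stack (y - ys) (u - us)) \<le> quad_form Q (stack (y - ys) (w - us))"
proof (cases rule: min_over_quad_form_cases [OF Q closed_stage, of y "y'" "y - ys" us,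
      case_names infeasible attained])
  case infeasible
  then show thesis
    by (intro that(1)) (auto simp: stage_cost_def)
next
  case (attained u)
  then show thesis
    by (intro that(2) [of u]) (auto simp: stage_cost_def)
qed

lemma terminal_cost_le:
  assumes "(y, u, \<gamma> *\<^sub>R y + (1 - \<gamma>) *\<^sub>R ys) \<in> S"
  shows "terminal_cost S \<gamma> P y ys us \<le> ereal (quad_form P (stack (y - ys) (u - us)))"
  by (rule terminal_cost_cases [where y = y and ys = ys and us = us]) (use assms in auto)

lemma stage_cost_le:
  assumes "(y, u, y') \<in> S"
  shows "stage_cost S Q y y' ys us \<le> ereal (quad_form Q (stack (y - ys) (u - us)))"
  by (rule stage_cost_cases [where y = y and y' = y' and ys = ys and us = us]) (use assms in auto)

text \<open>At \<open>ys\<close> the prescribed successor collapses to \<open>ys\<close> itself, so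
  \<open>us\<close> is feasible; its deviation is zero, and no value of the form is
  negative.\<close>

lemma terminal_cost_at_equilibrium:
  assumes "(ys, us, ys) \<in> S"
  shows "terminal_cost S \<gamma> P ys ys us = 0"
proof -
  have "min_over {u. (ys, u, \<gamma> *\<^sub>R ys + (1 - \<gamma>) *\<^sub>R ys) \<in> S}
      (\<lambda>u. ereal (quad_form P (stack (ys - ys) (u - us)))) =
    ereal (quad_form P (stack (ys - ys) (us - us)))"
    by (rule min_over_eqI)
      (use assms in \<open>auto simp: scaleR_left.add [symmetric] quad_form_nonneg [OF P]\<close>)
  then show ?thesis
    by (simp add: terminal_cost_def zero_ereal_def)
qed

text \<open>A nonzero first block keeps the stacked deviation nonzero for every input, so an
  attained value is positive; the remaining value is \<infinity>.\<close>

lemma terminal_cost_pos: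
  assumes "y \<noteq> ys"
  shows "terminal_cost S \<gamma> P y ys us > 0"
proof (rule terminal_cost_cases [where y = y and ys = ys and us = us])
  fix u
  assume "terminal_cost S \<gamma> P y ys us = ereal (quad_form P (stack (y - ys) (u - us)))"
  then show ?thesis
    using P assms by (simp add: sym_pos_def_def stack_eq_zero_iff)
qed simp

text \<open>The nested minimizations are merged into one over triples \<open>(y', w, u)\<close>,
  where \<open>w\<close> is the input in the terminal cost at \<open>y'\<close> and \<open>u\<close>
  the input in the stage cost from \<open>y\<close> to \<open>y'\<close>. This joint problem is
  closed and coercive, and the first component of a minimizer serves as \<open>y0\<close>.\<close>

lemma sum_attains_min:
  assumes feasible: "(y1, w1, \<gamma> *\<^sub>R y1 + (1 - \<gamma>) *\<^sub>R ys) \<in> S" "(y, u1, y1) \<in> S"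
  obtains y0 where
    "\<And>z. terminal_cost S \<gamma> P y0 ys us + stage_cost S Q y y0 ys us
      \<le> terminal_cost S \<gamma> P z ys us + stage_cost S Q y z ys us"
proof -
  define C where "C = {(y', w, u). (y', w, \<gamma> *\<^sub>R y' + (1 - \<gamma>) *\<^sub>R ys) \<in> S \<and> (y, u, y') \<in> S}"
  define f where "f = (\<lambda>(y', w, u). quad_form P (stack (y' - ys) (w - us))
    + quad_form Q (stack (y - ys) (u - us)))"
  have C_eq: "C = (\<lambda>z. (fst z, fst (snd z), \<gamma> *\<^sub>R fst z + (1 - \<gamma>) *\<^sub>R ys)) -` S
      \<inter> (\<lambda>z. (y, snd (snd z), fst z)) -` S"
    by (auto simp: C_def)
  have "closed C"
    unfolding C_eq by (intro closed_Int closed_vimage closed_S continuous_intros)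
  have "C \<noteq> {}"
    using feasible by (auto simp: C_def)
  have "continuous_on C f"
    unfolding f_def case_prod_unfold by (intro continuous_intros)
  obtain c where c: "c > 0" "\<And>z. c * (norm z)\<^sup>2 \<le> quad_form P z"
    using quad_form_coercive [OF P] by blast
  obtain d where d: "d > 0" "\<And>z. d * (norm z)\<^sup>2 \<le> quad_form Q z"
    using quad_form_coercive [OF Q] by blast
  \<comment> \<open>\<open>P\<close> controls \<open>y'\<close> and \<open>w\<close>, while
    \<open>Q\<close> controls \<open>u\<close>; the smaller coercivity constant serves for all three
    components.\<close>
  have bound: "min c d * (dist z (ys, us, us))\<^sup>2 \<le> f z" for z
  proof (cases z)
    case (fields y' w u)
    have "min c d * (dist z (ys, us, us))\<^sup>2 =
        min c d * (norm (stack (y' - ys) (w - us)))\<^sup>2 + min c d * (norm (u - us))\<^sup>2"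
      by (simp add: fields norm_Pair norm_stack dist_norm algebra_simps)
    also have "\<dots> \<le> c * (norm (stack (y' - ys) (w - us)))\<^sup>2
        + d * (norm (stack (y - ys) (u - us)))\<^sup>2"
      using c(1) d(1) by (intro add_mono mult_mono) (auto simp: norm_stack)
    also have "\<dots> \<le> f z"
      using add_mono [OF c(2) d(2)] by (simp add: fields f_def)
    finally show ?thesis .
  qed
  have "min c d > 0"
    using c(1) d(1) by simp
  obtain x where x: "x \<in> C" "\<And>z. z \<in> C \<Longrightarrow> f x \<le> f z"
    by (rule coercive_attains_inf [OF \<open>closed C\<close> \<open>C \<noteq> {}\<close> \<open>continuous_on C f\<close>
          \<open>min c d > 0\<close> bound]) (rule that)
  obtain y0 w0 u0 where x_eq: "x = (y0, w0, u0)"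
    by (cases x)
  show thesis
  proof
    fix z
    show "terminal_cost S \<gamma> P y0 ys us + stage_cost S Q y y0 ys us
      \<le> terminal_cost S \<gamma> P z ys us + stage_cost S Q y z ys us" (is "?l \<le> ?r")
    \<comment> \<open>If either cost on the right is infeasible, the sum is \<infinity>. Otherwise
      optimal inputs for \<open>z\<close> give a point of \<open>C\<close> to compare with
      \<open>x\<close>.\<close>
    proof (cases rule: terminal_cost_cases [where y = z and ys = ys and us = us])
      case (attained w)
      note w = attained
      show ?thesis
      proof (cases rule: stage_cost_cases [where y = y and y' = z and ys = ys and us = us])
        case (attained u)
        \<comment> \<open>Feasibility of \<open>w0\<close> and \<open>u0\<close> suffices here: each
          minimum on the left is at most the cost of a feasible input.\<close>
        have "?l \<le> ereal (quad_form P (stack (y0 - ys) (w0 - us)))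
            + ereal (quad_form Q (stack (y - ys) (u0 - us)))"
          using x(1) by (intro add_mono terminal_cost_le stage_cost_le) (auto simp: C_def x_eq)
        also have "\<dots> = ereal (f x)"
          by (simp add: f_def x_eq)
        also have "\<dots> \<le> ereal (f (z, w, u))"
          using x(2) [of "(z, w, u)"] w(1) attained(1) by (simp add: C_def)
        also have "\<dots> = ?r"
          using w(2) attained(2) by (simp add: f_def)
        finally show ?thesis .
      qed (use w in simp)
    qed simp
  qed
qed

lemma min_over_sum_le:
  assumes conv: "convex S" and \<gamma>: "0 \<le> \<gamma>" "\<gamma> \<le> 1" and le: "Q + \<gamma>\<^sup>2 *\<^sub>R P \<preceq>\<^sub>L P"
    and s: "(ys, us, ys) \<in> S" and y: "y \<in> terminal_set S \<gamma> P ys us"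
  shows "min_over UNIV (\<lambda>y'. terminal_cost S \<gamma> P y' ys us + stage_cost S Q y y' ys us)
    \<le> terminal_cost S \<gamma> P y ys us"
proof (cases rule: terminal_cost_cases [where y = y and ys = ys and us = us])
  case (attained u)
  define y1 where "y1 = \<gamma> *\<^sub>R y + (1 - \<gamma>) *\<^sub>R ys"
  define u1 where "u1 = \<gamma> *\<^sub>R u + (1 - \<gamma>) *\<^sub>R us"
  have u: "(y, u, y1) \<in> S"
    using attained(1) by (simp add: y1_def)
  \<comment> \<open>The third component of this combination is exactly the successor that the
    terminal cost prescribes for \<open>y1\<close>.\<close>
  have "\<gamma> *\<^sub>R (y, u, y1) + (1 - \<gamma>) *\<^sub>R (ys, us, ys) \<in> S"
    using conv u s \<gamma> by (intro convexD) auto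
  then have u1: "(y1, u1, \<gamma> *\<^sub>R y1 + (1 - \<gamma>) *\<^sub>R ys) \<in> S"
    by (simp add: y1_def u1_def)
  have "stack (y1 - ys) (u1 - us) = \<gamma> *\<^sub>R stack (y - ys) (u - us)"
    by (simp add: y1_def u1_def stack_scaleR [symmetric] algebra_simps)
  then have P1: "quad_form P (stack (y1 - ys) (u1 - us)) =
      \<gamma>\<^sup>2 * quad_form P (stack (y - ys) (u - us))"
    by (simp add: quad_form_scaleR)
  obtain y0 where y0: "\<And>z. terminal_cost S \<gamma> P y0 ys us + stage_cost S Q y y0 ys us
      \<le> terminal_cost S \<gamma> P z ys us + stage_cost S Q y z ys us"
    using sum_attains_min [OF u1 u] by blast
  \<comment> \<open>The minimizer \<open>y0\<close> is needed to give \<open>min_over\<close> its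
    meaning; the candidate \<open>y1\<close> alone would bound only an infimum.\<close>
  then have "min_over UNIV (\<lambda>y'. terminal_cost S \<gamma> P y' ys us + stage_cost S Q y y' ys us) =
      terminal_cost S \<gamma> P y0 ys us + stage_cost S Q y y0 ys us"
    by (intro min_over_eqI) auto
  also have "\<dots> \<le> terminal_cost S \<gamma> P y1 ys us + stage_cost S Q y y1 ys us"
    by (rule y0)
  also have "\<dots> \<le> ereal (quad_form P (stack (y1 - ys) (u1 - us)))
      + ereal (quad_form Q (stack (y - ys) (u - us)))"
    by (intro add_mono terminal_cost_le stage_cost_le u u1)
  \<comment> \<open>By \<open>P1\<close> the left side is the form of
    \<open>Q + \<gamma>\<^sup>2 *\<^sub>R P\<close> at the deviation of \<open>(y, u)\<close>, so
    the matrix inequality applies directly.\<close>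
  also have "\<dots> \<le> ereal (quad_form P (stack (y - ys) (u - us)))"
    using quad_form_loewner_le [OF le, of "stack (y - ys) (u - us)"]
    by (simp add: P1 quad_form_add quad_form_scaleR_matrix)
  also have "\<dots> = terminal_cost S \<gamma> P y ys us"
    using attained(2) by simp
  finally show ?thesis .
qed (use y in \<open>simp add: terminal_set_def\<close>)

end

section \<open>Closedness and convexity of the tube set\<close>

lemma closed_vec_atMost: "closed {..b :: real^'n}"
  using closed_interval_left_cart [of b] by (simp add: atMost_def less_eq_vec_def)

lemma convex_vec_atMost: "convex {..b :: real^'n}"
  by (rule convexI)
    (auto simp: less_eq_vec_def intro: convex_bound_le)

text \<open>Moving the successor to the left and the disturbance bound to the right turns the
  dynamics constraint into a linear map landing in a fixed orthant, so preimage rules for closed and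
  convex sets apply to every constraint.\<close>

lemma tube_set_eq_vimage:
  "tube_set X U W A B F E V = (\<Inter>i. \<Inter>j.
     (\<lambda>z. F *v (A i *v (V j *v fst z) + B i *v (block_mat j *v fst (snd z))) - snd (snd z))
       -` {..- disturbance_bound F W}
     \<inter> (\<lambda>z. E *v fst z) -` {..0} \<inter> (\<lambda>z. V j *v fst z) -` X
     \<inter> (\<lambda>z. block_mat j *v fst (snd z)) -` U)"
  by (auto simp: tube_set_def algebra_simps less_eq_vec_def)

lemma linear_matrix_vector_comp:
  "linear f \<Longrightarrow> linear (\<lambda>z. (M :: real^'a^'b) *v f z)"
  using linear_compose [of f "(*v) M"] by (simp add: o_def)

lemma linear_tube_constraint:
  fixes A :: "real^'nx^'nx" and B :: "real^'nu^'nx" and F :: "real^'nx^'m"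
  shows "linear (\<lambda>z. F *v (A *v (V *v fst z) + B *v (K *v fst (snd z))) - snd (snd z))"
  using linear_compose [OF linear_snd linear_fst] linear_compose [OF linear_snd linear_snd]
  by (intro linear_compose_sub linear_matrix_vector_comp linear_compose_add linear_fst)
    (auto simp: o_def)

lemma convex_tube_set:
  assumes "convex X" "convex U"
  shows "convex (tube_set X U W A B F E V)"
  unfolding tube_set_eq_vimage
  using linear_compose [OF linear_snd linear_fst]
  by (intro convex_INT convex_Int convex_linear_vimage convex_vec_atMost linear_tube_constraint
        linear_matrix_vector_comp linear_fst assms) (auto simp: o_def)

lemma closed_tube_set:
  assumes "closed X" "closed U"
  shows "closed (tube_set X U W A B F E V)"
  unfolding tube_set_eq_vimage
  by (intro closed_INT ballI closed_Int closed_vimage closed_vec_atMost assms continuous_intros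
      bounded_linear.continuous_on [OF matrix_vector_mul_bounded_linear])

theorem theorem1:
  fixes X W :: "(real^'nx) set"
    and U :: "(real^'nu) set"
    and A :: "'p::finite \<Rightarrow> real^'nx^'nx"
    and B :: "'p \<Rightarrow> real^'nu^'nx"
    and F :: "real^'nx^'m"
    and E :: "real^'m^'e"
    and V :: "'v::finite \<Rightarrow> real^'m^'nx"
    and \<gamma> :: real
    and Q P :: "real^('m + 'v \<times> 'nu)^('m + 'v \<times> 'nu)"
    and S :: "((real^'m) \<times> (real^('v \<times> 'nu)) \<times> (real^'m)) set"
  assumes "closed X" "convex X"
    and "closed U" "convex U"
    and "compact W" "convex W" "W \<noteq> {}"
    and "\<And>y. E *v y \<le> 0 \<Longrightarrow> polytope_of F y = convex hull (range (\<lambda>j. V j *v y))"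
    and "S = tube_set X U W A B F E V"
    and "0 \<le> \<gamma>" "\<gamma> < 1"
    and "sym_pos_def Q" "sym_pos_def P"
    and "\<exists>y u. (y, u, y) \<in> S"
  shows "(\<forall>ys us. (ys, us, ys) \<in> S \<longrightarrow>
            terminal_cost S \<gamma> P ys ys us = 0 \<and>
            (\<forall>y. y \<noteq> ys \<longrightarrow> terminal_cost S \<gamma> P y ys us > 0)) \<and>
         (Q + \<gamma>\<^sup>2 *\<^sub>R P \<preceq>\<^sub>L P \<longrightarrow>
           (\<forall>ys us. (ys, us, ys) \<in> S \<longrightarrow>
             (\<forall>y \<in> terminal_set S \<gamma> P ys us.
                min_over UNIV (\<lambda>y'. terminal_cost S \<gamma> P y' ys us + stage_cost S Q y y' ys us)
                  \<le> terminal_cost S \<gamma> P y ys us)))"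
proof -
  \<comment> \<open>Closedness feeds the locale and thus all attainment results; convexity is passed
    separately to the descent inequality.\<close>
  have "closed S" "convex S"
    unfolding \<open>S = tube_set X U W A B F E V\<close>
    by (intro closed_tube_set convex_tube_set assms)+
  then interpret closed_triples S \<gamma> Q P
    using \<open>sym_pos_def Q\<close> \<open>sym_pos_def P\<close> by unfold_locales
  show ?thesis
    using terminal_cost_at_equilibrium terminal_cost_pos
      min_over_sum_le [OF \<open>convex S\<close> \<open>0 \<le> \<gamma>\<close> less_imp_le [OF \<open>\<gamma> < 1\<close>]]
    by blast
qed

end
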